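(* Let $\mathbf n=(n_k)_{k\ge1}$ and $\mathbf s=(s_k)_{k\ge1}$ be strictly increasing sequences of positive integers, and suppose $\mathbf s$ has arbitrarily large additive gaps, i.e. $\sup_k(s_{k+1}-s_k)=\infty$. Then there is a Banach space $X$ with a $1$-unconditional basis that is $\mathbf s$-($\mathbf n$, strong partially greedy) but is not ($\mathbf n$, conservative).
   Context: Banach spaces are separable, infinite-dimensional, over $\mathbb F=\mathbb R$ or $\mathbb C$; $\mathbb N=\{1,2,\dots\}$. A basis of $X$ is a sequence $\mathcal B=(e_n)_{n\ge1}\subset X$ whose linear span is norm-dense and for which there is a sequence $(e_n^* )_{n\ge1}\subset X^*$ with $e_j^*(e_k)=\delta_{j,k}$ and $0<\inf_n\{\|e_n\|,\|e_n^*\|\}\le\sup_n\{\|e_n\|,\|e_n^*\|\}<\infty$. It is $1$-unconditional if for all $N\in\mathbb N$, $\|\sum_{n=1}^Na_ne_n\|\le\|\sum_{n=1}^Nb_ne_n\|$ whenever $|a_n|\le|b_n|$ for $1\le n\le N$. Sequences are identified with their sets of terms. For finite $A\subset\mathbb N$, $P_A(x)=\sum_{n\in A}e_n^*(x)e_n$ and $1_A=\sum_{n\in A}e_n$. For $x\in X$, $m\in\mathbb N$, a greedy set of $x$ of order $m$ is a set $A\subset\mathbb N$ with $|A|=m$ and $\min_{n\in A}|e_n^*(x)|\ge\max_{n\notin A}|e_n^*(x)|$; $G_m(x)$ denotes $P_A(x)$ for such an $A$ (not necessarily unique). Put $P^{\mathbf n}_0(x)=0$, $P^{\mathbf n}_k(x)=\sum_{i=1}^k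 e_{n_i}^*(x)e_{n_i}$, $\widehat\sigma^{\mathbf n}_m(x)=\min_{0\le k\le m}\|x-P^{\mathbf n}_k(x)\|$. $\mathcal B$ is $\mathbf s$-($\mathbf n$, strong partially greedy) if there is $C\ge1$ with $\|x-G_m(x)\|\le C\,\widehat\sigma^{\mathbf n}_m(x)$ for all $x\in X$, all $m\in\mathbf s$ and all choices of $G_m(x)$. $\mathcal B$ is ($\mathbf n$, conservative) if there is $C>0$ with $\|1_A\|\le C\|1_B\|$ for all finite sets $A\subset\mathbf n$, $B\subset\mathbb N$ with $|A|\le|B|$ and $a<b$ for all $a\in A$, $b\in B\cap\mathbf n$. *)

theory Defs
  imports "HOL-Analysis.Analysis" "HOL-Library.Function_Algebras"
begin

text \<open>
  Normed spaces over a field of scalars are given by a subspace \<open>X\<close> of an ambient vector space and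
  a norm whose values matter on \<open>X\<close> only, so that one can assert the existence of a space inside a
  formula. All sequences are indexed by the positive integers; values at index 0 are irrelevant.
\<close>

locale normed_space_on = vector_space smul
  for smul :: "'k::real_normed_field \<Rightarrow> 'v::ab_group_add \<Rightarrow> 'v" +
  fixes X :: "'v set" and nrm :: "'v \<Rightarrow> real"
  assumes subspace_X: "subspace X"
    and nrm_nonneg: "x \<in> X \<Longrightarrow> 0 \<le> nrm x"
    and nrm_eq_0_iff: "x \<in> X \<Longrightarrow> nrm x = 0 \<longleftrightarrow> x = 0"
    and nrm_scale: "x \<in> X \<Longrightarrow> nrm (smul c x) = norm c * nrm x"
    and nrm_triangle: "x \<in> X \<Longrightarrow> y \<in> X \<Longrightarrow> nrm (x + y) \<le> nrm x + nrm y"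
begin

text \<open>Set to 0 off \<open>X\<close> because the library's metric spaces require nonnegativity and symmetry
  on the whole type.\<close>

definition nrm_dist :: "'v \<Rightarrow> 'v \<Rightarrow> real" where
  "nrm_dist x y = (if x \<in> X \<and> y \<in> X then nrm (x - y) else 0)"

sublocale Metric_space X nrm_dist
proof
  have diff: "x - y \<in> X" if "x \<in> X" "y \<in> X" for x y
    using subspace_diff[OF subspace_X] that by blast
  show "0 \<le> nrm_dist x y" for x y
    by (simp add: nrm_dist_def diff nrm_nonneg)
  have "nrm (x - y) = nrm (y - x)" if "x \<in> X" "y \<in> X" for x y
    using nrm_scale[OF diff[OF that], of "- 1"] by simp
  then show "nrm_dist x y = nrm_dist y x" for x y
    by (simp add: nrm_dist_def)
  show "nrm_dist x y = 0 \<longleftrightarrow> x = y" if "x \<in> X" "y \<in> X" for x y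
    using that by (simp add: nrm_dist_def diff nrm_eq_0_iff)
  show "nrm_dist x z \<le> nrm_dist x y + nrm_dist y z" if "x \<in> X" "y \<in> X" "z \<in> X" for x y z
    using nrm_triangle[of "x - y" "y - z"] that by (simp add: nrm_dist_def diff)
qed

definition dual_space :: "('v \<Rightarrow> 'k) set" where
  "dual_space = {f. (\<forall>x\<in>X. \<forall>y\<in>X. f (x + y) = f x + f y) \<and>
                    (\<forall>c. \<forall>x\<in>X. f (smul c x) = c * f x) \<and>
                    (\<exists>C. \<forall>x\<in>X. norm (f x) \<le> C * nrm x)}"

definition dual_norm :: "('v \<Rightarrow> 'k) \<Rightarrow> real" where
  "dual_norm f = (SUP x\<in>{x \<in> X. nrm x \<le> 1}. norm (f x))"

end

locale separable_banach_space_on = normed_space_on +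
  assumes complete: "mcomplete"
    and separable: "separable_space mtopology"
    and infinite_dimensional: "\<nexists>B. finite B \<and> X \<subseteq> span B"

text \<open>On \<open>X\<close> the functionals \<open>e'\<close> are determined by \<open>e\<close>, by density of the span and continuity.\<close>

locale banach_basis = separable_banach_space_on +
  fixes e :: "nat \<Rightarrow> 'b" and e' :: "nat \<Rightarrow> 'b \<Rightarrow> 'a"
  assumes basis_in_X: "e ` {1..} \<subseteq> X"
    and dense_span: "mtopology closure_of (span (e ` {1..})) = X"
    and coord_in_dual: "e' ` {1..} \<subseteq> dual_space"
    and biorthogonal: "j \<ge> 1 \<Longrightarrow> k \<ge> 1 \<Longrightarrow> e' j (e k) = (if j = k then 1 else 0)"
    and seminormalized_below: "0 < Inf ((\<lambda>i. nrm (e i)) ` {1..} \<union> (\<lambda>i. dual_norm (e' i)) ` {1..})"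
    and seminormalized_above: "bdd_above ((\<lambda>i. nrm (e i)) ` {1..} \<union> (\<lambda>i. dual_norm (e' i)) ` {1..})"

definition one_unconditional ::
  "('k::real_normed_field \<Rightarrow> 'v::ab_group_add \<Rightarrow> 'v) \<Rightarrow> ('v \<Rightarrow> real) \<Rightarrow> (nat \<Rightarrow> 'v) \<Rightarrow> bool" where
  "one_unconditional smul nrm e \<longleftrightarrow>
     (\<forall>N\<ge>1. \<forall>a b. (\<forall>i\<in>{1..N}. norm (a i) \<le> norm (b i)) \<longrightarrow>
        nrm (\<Sum>i=1..N. smul (a i) (e i)) \<le> nrm (\<Sum>i=1..N. smul (b i) (e i)))"

definition coord_proj ::
  "('k \<Rightarrow> 'v::ab_group_add \<Rightarrow> 'v) \<Rightarrow> (nat \<Rightarrow> 'v) \<Rightarrow> (nat \<Rightarrow> 'v \<Rightarrow> 'k) \<Rightarrow> nat set \<Rightarrow> 'v \<Rightarrow> 'v" where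
  "coord_proj smul e e' A x = (\<Sum>i\<in>A. smul (e' i x) (e i))"

definition greedy_set ::
  "(nat \<Rightarrow> 'v \<Rightarrow> 'k::real_normed_field) \<Rightarrow> 'v \<Rightarrow> nat \<Rightarrow> nat set \<Rightarrow> bool" where
  "greedy_set e' x m A \<longleftrightarrow> finite A \<and> A \<subseteq> {1..} \<and> card A = m \<and>
     (\<forall>i\<in>A. \<forall>j\<in>{1..} - A. norm (e' j x) \<le> norm (e' i x))"

definition seq_partial_sum ::
  "('k \<Rightarrow> 'v::ab_group_add \<Rightarrow> 'v) \<Rightarrow> (nat \<Rightarrow> 'v) \<Rightarrow> (nat \<Rightarrow> 'v \<Rightarrow> 'k) \<Rightarrow> (nat \<Rightarrow> nat) \<Rightarrow> nat \<Rightarrow> 'v \<Rightarrow> 'v"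
  where "seq_partial_sum smul e e' n k x = (\<Sum>i=1..k. smul (e' (n i) x) (e (n i)))"

definition seq_sigma ::
  "('k \<Rightarrow> 'v::ab_group_add \<Rightarrow> 'v) \<Rightarrow> ('v \<Rightarrow> real) \<Rightarrow> (nat \<Rightarrow> 'v) \<Rightarrow> (nat \<Rightarrow> 'v \<Rightarrow> 'k) \<Rightarrow>
     (nat \<Rightarrow> nat) \<Rightarrow> nat \<Rightarrow> 'v \<Rightarrow> real" where
  "seq_sigma smul nrm e e' n m x = Min ((\<lambda>k. nrm (x - seq_partial_sum smul e e' n k x)) ` {0..m})"

definition strong_partially_greedy ::
  "('k::real_normed_field \<Rightarrow> 'v::ab_group_add \<Rightarrow> 'v) \<Rightarrow> 'v set \<Rightarrow> ('v \<Rightarrow> real) \<Rightarrow>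
     (nat \<Rightarrow> 'v) \<Rightarrow> (nat \<Rightarrow> 'v \<Rightarrow> 'k) \<Rightarrow> (nat \<Rightarrow> nat) \<Rightarrow> (nat \<Rightarrow> nat) \<Rightarrow> bool" where
  "strong_partially_greedy smul X nrm e e' s n \<longleftrightarrow>
     (\<exists>C\<ge>1. \<forall>x\<in>X. \<forall>m \<in> s ` {1..}. \<forall>A. greedy_set e' x m A \<longrightarrow>
        nrm (x - coord_proj smul e e' A x) \<le> C * seq_sigma smul nrm e e' n m x)"

definition conservative ::
  "('v::ab_group_add \<Rightarrow> real) \<Rightarrow> (nat \<Rightarrow> 'v) \<Rightarrow> (nat \<Rightarrow> nat) \<Rightarrow> bool" where
  "conservative nrm e n \<longleftrightarrow>
     (\<exists>C>0. \<forall>A B. finite A \<and> finite B \<and> A \<subseteq> n ` {1..} \<and> B \<subseteq> {1..} \<and> card A \<le> card B \<and>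
        (\<forall>a\<in>A. \<forall>b \<in> B \<inter> n ` {1..}. a < b) \<longrightarrow>
        nrm (\<Sum>i\<in>A. e i) \<le> C * nrm (\<Sum>i\<in>B. e i))"

end

theory Submission
  imports Defs
begin

text \<open>
  The space is a combinatorial one. For a family \<open>\<F>\<close> of finite subsets of \<open>{1, 2, \<dots>}\<close> that is
  closed under subsets and contains the singletons, complete the finitely supported sequences in
  the norm \<open>\<parallel>x\<parallel> = sup {\<Sum>i\<in>F. |x i| | F \<in> \<F>}\<close>. The unit vectors then form a \<open>1\<close>-unconditional
  basis (\<open>banach_basis_unit_seq\<close>), and it remains to choose \<open>\<F>\<close>.

  Take gaps of \<open>s\<close> that follow one another: no term of \<open>s\<close> lies strictly between \<open>S j\<close> and
  \<open>S j + 4 q j\<close>, where \<open>q j = (j + 1)!\<close>. Inside the \<open>j\<close>-th gap put two consecutive blocks of \<open>q j\<close>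
  terms of \<open>n\<close>: first a heavy block, on which the norm of the indicator is \<open>q j\<close>, then a light
  block, on which it is at most \<open>j! = q j / (j + 1)\<close>. This defeats conservativity, since the light
  block lies to the right of the heavy one. It is achieved by letting \<open>F \<in> \<F>\<close> meet the \<open>j\<close>-th light
  block in at most \<open>j!\<close> points. For the sets before the gap not to dominate the light block as well,
  \<open>F\<close> may have up to \<open>q j\<close> elements only if it avoids the first \<open>S j\<close> terms of \<open>n\<close>.

  The greedy algorithm does not notice the light blocks when the number \<open>m\<close> of terms is in \<open>s\<close>. By
  unconditionality, comparing a greedy set \<open>A\<close> with an initial segment \<open>D\<close> of \<open>n\<close> of length
  \<open>k \<le> m\<close> amounts to bounding the part of \<open>x\<close> on a set \<open>G \<in> \<F>\<close> inside \<open>D - A\<close> by the part on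
  \<open>A - D\<close>, where the coefficients are at least as large and which has at least
  \<open>(m - k) + card G\<close> elements (\<open>greedy_error_le\<close>). So one only needs a member of \<open>\<F>\<close> of the size of
  \<open>G\<close> inside \<open>A - D\<close> (\<open>gap_family_exchange\<close>). If \<open>G\<close> has more than one element, then
  \<open>card G \<le> q j\<close> and \<open>G\<close> avoids the first \<open>S j\<close> terms of \<open>n\<close> for some \<open>j\<close>; hence \<open>k > S j\<close>, and
  \<open>m\<close> is past the \<open>j\<close>-th gap. If \<open>k\<close> is past the light block, \<open>A - D\<close> does not meet it; otherwise
  \<open>m - k\<close> is so large that \<open>A - D\<close> keeps \<open>q j\<close> elements after the light block is removed. Later
  light blocks impose no restriction, because \<open>q j \<le> i!\<close> for \<open>i > j\<close>.
\<close>

section \<open>Sequence spaces normed by a hereditary family of finite sets\<close>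

definition pointwise_scale :: "'k::real_normed_field \<Rightarrow> (nat \<Rightarrow> 'k) \<Rightarrow> nat \<Rightarrow> 'k" where
  "pointwise_scale c x = (\<lambda>i. c * x i)"

definition unit_seq :: "nat \<Rightarrow> nat \<Rightarrow> 'k::real_normed_field" where
  "unit_seq i = (\<lambda>j. if j = i then 1 else 0)"

definition family_norm :: "nat set set \<Rightarrow> (nat \<Rightarrow> 'k::real_normed_field) \<Rightarrow> real" where
  "family_norm \<F> x = (SUP F\<in>\<F>. \<Sum>i\<in>F. norm (x i))"

text \<open>The condition on tails describes the norm closure of the finitely supported sequences that
  vanish at the index 0, which belongs to no basis vector. It also makes the supremum defining the
  norm finite.\<close>

definition family_space :: "nat set set \<Rightarrow> (nat \<Rightarrow> 'k::real_normed_field) set" where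
  "family_space \<F> =
     {x. x 0 = 0 \<and> (\<forall>\<epsilon>>0. \<exists>N. \<forall>F\<in>\<F>. F \<subseteq> {N..} \<longrightarrow> (\<Sum>i\<in>F. norm (x i)) \<le> \<epsilon>)}"

lemma pointwise_scale_apply [simp]: "pointwise_scale c x i = c * x i"
  by (simp add: pointwise_scale_def)

lemma sum_fun_apply: "(\<Sum>i\<in>A. f i) x = (\<Sum>i\<in>A. f i x)"
  for f :: "'i \<Rightarrow> 'x \<Rightarrow> 'k::comm_monoid_add"
  by (induction A rule: infinite_finite_induct) auto

lemma unit_expansion_apply:
  assumes "finite A"
  shows "(\<Sum>i\<in>A. pointwise_scale (a i) (unit_seq i)) j = (if j \<in> A then a j else 0)"
proof -
  have "(\<Sum>i\<in>A. pointwise_scale (a i) (unit_seq i)) j = (\<Sum>i\<in>A. if j = i then a i else 0)"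
    by (auto simp: sum_fun_apply unit_seq_def intro!: sum.cong)
  with assms show ?thesis
    by simp
qed

lemma unit_sum_apply:
  assumes "finite A"
  shows "(\<Sum>i\<in>A. unit_seq i) j = (if j \<in> A then 1 else (0::'k::real_normed_field))"
proof -
  have "(\<Sum>i\<in>A. unit_seq i) j = (\<Sum>i\<in>A. if j = i then 1 else (0::'k))"
    by (auto simp: sum_fun_apply unit_seq_def intro!: sum.cong)
  with assms show ?thesis
    by simp
qed

lemma coord_proj_unit_seq:
  assumes "finite A"
  shows "coord_proj pointwise_scale unit_seq (\<lambda>i x. x i) A x = (\<lambda>j. if j \<in> A then x j else 0)"
  unfolding coord_proj_def by (rule ext) (rule unit_expansion_apply[OF assms])

lemma vector_space_pointwise_scale:
  "vector_space (pointwise_scale :: 'k::real_normed_field \<Rightarrow> _)"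
  by unfold_locales (auto simp: fun_eq_iff algebra_simps)

locale hereditary_family =
  fixes \<F> :: "nat set set"
  assumes finite_member: "F \<in> \<F> \<Longrightarrow> finite F"
    and member_pos: "F \<in> \<F> \<Longrightarrow> F \<subseteq> {1..}"
    and singleton_member: "1 \<le> i \<Longrightarrow> {i} \<in> \<F>"
    and subset_member: "F \<in> \<F> \<Longrightarrow> G \<subseteq> F \<Longrightarrow> G \<in> \<F>"
begin

lemma nonempty: "\<F> \<noteq> {}"
  using singleton_member[of 1] by auto

lemma family_space_zero: "x \<in> family_space \<F> \<Longrightarrow> x 0 = 0"
  by (simp add: family_space_def)

lemma family_spaceD:
  assumes "x \<in> family_space \<F>" "\<epsilon> > 0"
  obtains N where "\<And>F. F \<in> \<F> \<Longrightarrow> F \<subseteq> {N..} \<Longrightarrow> (\<Sum>i\<in>F. norm (x i)) \<le> \<epsilon>"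
  using assms unfolding family_space_def by blast

text \<open>A member of the family is cut at an index: below it all coordinates are controlled one by one,
  above it a tail condition applies.\<close>

lemma sum_split_at:
  assumes "F \<in> \<F>" "\<And>i. 0 \<le> (f i :: real)"
    and "\<And>i. i < N \<Longrightarrow> f i \<le> b i" "\<And>F. F \<in> \<F> \<Longrightarrow> F \<subseteq> {N..} \<Longrightarrow> (\<Sum>i\<in>F. f i) \<le> c"
  shows "(\<Sum>i\<in>F. f i) \<le> (\<Sum>i<N. b i) + c"
proof -
  have "(\<Sum>i\<in>F. f i) = (\<Sum>i\<in>F \<inter> {..<N}. f i) + (\<Sum>i\<in>F - {..<N}. f i)"
    using finite_member[OF assms(1)] by (simp add: sum.Int_Diff)
  also have "(\<Sum>i\<in>F \<inter> {..<N}. f i) \<le> (\<Sum>i<N. f i)"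
    by (rule sum_mono2) (use assms(2) in auto)
  also have "\<dots> \<le> (\<Sum>i<N. b i)"
    by (rule sum_mono) (use assms(3) in auto)
  also have "(\<Sum>i\<in>F - {..<N}. f i) \<le> c"
    by (rule assms(4)) (auto intro: subset_member[OF assms(1)])
  finally show ?thesis by simp
qed

lemma bdd_above_sums:
  assumes "x \<in> family_space \<F>"
  shows "bdd_above ((\<lambda>F. \<Sum>i\<in>F. norm (x i)) ` \<F>)"
proof -
  obtain N where N: "\<And>F. F \<in> \<F> \<Longrightarrow> F \<subseteq> {N..} \<Longrightarrow> (\<Sum>i\<in>F. norm (x i)) \<le> 1"
    using family_spaceD[OF assms, of 1] by auto
  have "(\<Sum>i\<in>F. norm (x i)) \<le> (\<Sum>i<N. norm (x i)) + 1" if "F \<in> \<F>" for F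
    by (rule sum_split_at) (use that N in auto)
  then show ?thesis
    by (auto simp: bdd_above_def)
qed

lemma sum_le_family_norm:
  assumes "x \<in> family_space \<F>" "F \<in> \<F>"
  shows "(\<Sum>i\<in>F. norm (x i)) \<le> family_norm \<F> x"
  unfolding family_norm_def by (rule cSUP_upper[OF assms(2) bdd_above_sums[OF assms(1)]])

lemma family_norm_le:
  assumes "\<And>F. F \<in> \<F> \<Longrightarrow> (\<Sum>i\<in>F. norm (x i)) \<le> c"
  shows "family_norm \<F> x \<le> c"
  unfolding family_norm_def by (rule cSUP_least[OF nonempty assms])

lemma coordinate_le_family_norm:
  assumes "x \<in> family_space \<F>"
  shows "norm (x i) \<le> family_norm \<F> x"
proof (cases "i = 0")
  case True
  have "0 = (\<Sum>i\<in>{}. norm (x i))" by simp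
  also have "\<dots> \<le> family_norm \<F> x"
    by (rule sum_le_family_norm[OF assms subset_member[OF singleton_member[of 1]]]) auto
  finally show ?thesis
    using family_space_zero[OF assms] True by simp
next
  case False
  then show ?thesis
    using sum_le_family_norm[OF assms singleton_member[of i]] by simp
qed

lemma finite_support_in_family_space:
  assumes "x 0 = 0" "finite {i. x i \<noteq> 0}"
  shows "x \<in> family_space \<F>"
proof -
  obtain N where N: "\<And>i. x i \<noteq> 0 \<Longrightarrow> i < N"
    using finite_nat_bounded[OF assms(2)] by auto
  have "(\<Sum>i\<in>F. norm (x i)) = 0" if "F \<subseteq> {N..}" for F
    by (rule sum.neutral) (use that N in force)
  then have "\<exists>N. \<forall>F\<in>\<F>. F \<subseteq> {N..} \<longrightarrow> (\<Sum>i\<in>F. norm (x i)) \<le> \<epsilon>" if "\<epsilon> > 0" for \<epsilon>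
    using that by (intro exI[of _ N]) simp
  with assms(1) show ?thesis
    unfolding family_space_def by blast
qed

lemma unit_seq_in_family_space: "1 \<le> i \<Longrightarrow> unit_seq i \<in> family_space \<F>"
  by (rule finite_support_in_family_space) (auto simp: unit_seq_def)

lemma family_space_mono:
  assumes x: "x \<in> family_space \<F>" and le: "\<And>i. norm (y i) \<le> norm (x i)"
  shows "y \<in> family_space \<F>"
  unfolding family_space_def mem_Collect_eq
proof (intro conjI allI impI)
  show "y 0 = 0"
    using le[of 0] family_space_zero[OF x] by simp
  fix \<epsilon> :: real assume "\<epsilon> > 0"
  then obtain N where N: "\<And>F. F \<in> \<F> \<Longrightarrow> F \<subseteq> {N..} \<Longrightarrow> (\<Sum>i\<in>F. norm (x i)) \<le> \<epsilon>"
    using family_spaceD[OF x] by blast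
  have "(\<Sum>i\<in>F. norm (y i)) \<le> \<epsilon>" if "F \<in> \<F>" "F \<subseteq> {N..}" for F
    using N[OF that] sum_mono[of F "\<lambda>i. norm (y i)" "\<lambda>i. norm (x i)"] le by fastforce
  then show "\<exists>N. \<forall>F\<in>\<F>. F \<subseteq> {N..} \<longrightarrow> (\<Sum>i\<in>F. norm (y i)) \<le> \<epsilon>"
    by blast
qed

lemma family_norm_mono:
  assumes "x \<in> family_space \<F>" "\<And>i. norm (y i) \<le> norm (x i)"
  shows "family_norm \<F> y \<le> family_norm \<F> x"
proof (rule family_norm_le)
  fix F assume F: "F \<in> \<F>"
  show "(\<Sum>i\<in>F. norm (y i)) \<le> family_norm \<F> x"
    by (rule order_trans[OF sum_mono sum_le_family_norm[OF assms(1) F]]) (rule assms(2))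
qed

lemma family_space_add:
  assumes x: "x \<in> family_space \<F>" and y: "y \<in> family_space \<F>"
  shows "x + y \<in> family_space \<F>"
  unfolding family_space_def mem_Collect_eq
proof (intro conjI allI impI)
  show "(x + y) 0 = 0"
    using family_space_zero[OF x] family_space_zero[OF y] by simp
  fix \<epsilon> :: real assume "\<epsilon> > 0"
  then have "\<epsilon> / 2 > 0" by simp
  obtain N where N: "\<And>F. F \<in> \<F> \<Longrightarrow> F \<subseteq> {N..} \<Longrightarrow> (\<Sum>i\<in>F. norm (x i)) \<le> \<epsilon> / 2"
    using family_spaceD[OF x \<open>\<epsilon> / 2 > 0\<close>] by blast
  obtain M where M: "\<And>F. F \<in> \<F> \<Longrightarrow> F \<subseteq> {M..} \<Longrightarrow> (\<Sum>i\<in>F. norm (y i)) \<le> \<epsilon> / 2"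
    using family_spaceD[OF y \<open>\<epsilon> / 2 > 0\<close>] by blast
  have "(\<Sum>i\<in>F. norm ((x + y) i)) \<le> \<epsilon>" if F: "F \<in> \<F>" "F \<subseteq> {max M N..}" for F
  proof -
    have "(\<Sum>i\<in>F. norm ((x + y) i)) \<le> (\<Sum>i\<in>F. norm (x i)) + (\<Sum>i\<in>F. norm (y i))"
      by (simp add: sum.distrib[symmetric] sum_mono norm_triangle_ineq)
    moreover have "F \<subseteq> {N..}" "F \<subseteq> {M..}" using F by auto
    ultimately show ?thesis
      using N[OF F(1)] M[OF F(1)] by simp
  qed
  then show "\<exists>N. \<forall>F\<in>\<F>. F \<subseteq> {N..} \<longrightarrow> (\<Sum>i\<in>F. norm ((x + y) i)) \<le> \<epsilon>"
    by blast
qed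

lemma family_space_scale:
  assumes x: "x \<in> family_space \<F>"
  shows "pointwise_scale c x \<in> family_space \<F>"
  unfolding family_space_def mem_Collect_eq
proof (intro conjI allI impI)
  show "pointwise_scale c x 0 = 0"
    using family_space_zero[OF x] by simp
  fix \<epsilon> :: real assume "\<epsilon> > 0"
  then have "\<epsilon> / (norm c + 1) > 0"
    by (simp add: add_nonneg_pos)
  then obtain N where N: "\<And>F. F \<in> \<F> \<Longrightarrow> F \<subseteq> {N..} \<Longrightarrow> (\<Sum>i\<in>F. norm (x i)) \<le> \<epsilon> / (norm c + 1)"
    using family_spaceD[OF x] by blast
  have "(\<Sum>i\<in>F. norm (pointwise_scale c x i)) \<le> \<epsilon>" if F: "F \<in> \<F>" "F \<subseteq> {N..}" for F
  proof -
    have "(\<Sum>i\<in>F. norm (pointwise_scale c x i)) = norm c * (\<Sum>i\<in>F. norm (x i))"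
      by (simp add: norm_mult sum_distrib_left)
    also have "\<dots> \<le> (norm c + 1) * (\<epsilon> / (norm c + 1))"
      by (rule mult_mono) (use N[OF F] in \<open>auto intro: sum_nonneg\<close>)
    also have "\<dots> = \<epsilon>"
    proof -
      have "norm c + 1 \<noteq> 0"
        using norm_ge_zero[of c] by linarith
      then show ?thesis by simp
    qed
    finally show ?thesis .
  qed
  then show "\<exists>N. \<forall>F\<in>\<F>. F \<subseteq> {N..} \<longrightarrow> (\<Sum>i\<in>F. norm (pointwise_scale c x i)) \<le> \<epsilon>"
    by blast
qed

lemma family_norm_scale_le:
  assumes "x \<in> family_space \<F>"
  shows "family_norm \<F> (pointwise_scale c x) \<le> norm c * family_norm \<F> x"
proof (rule family_norm_le)
  fix F assume F: "F \<in> \<F>"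
  have "(\<Sum>i\<in>F. norm (pointwise_scale c x i)) = norm c * (\<Sum>i\<in>F. norm (x i))"
    by (simp add: norm_mult sum_distrib_left)
  also have "\<dots> \<le> norm c * family_norm \<F> x"
    by (rule mult_left_mono[OF sum_le_family_norm[OF assms F]]) simp
  finally show "(\<Sum>i\<in>F. norm (pointwise_scale c x i)) \<le> norm c * family_norm \<F> x" .
qed

lemma normed_space_on_family_space:
  "normed_space_on pointwise_scale (family_space \<F> :: (nat \<Rightarrow> 'k::real_normed_field) set)
     (family_norm \<F>)"
proof -
  interpret vector_space "pointwise_scale :: 'k \<Rightarrow> _"
    by (rule vector_space_pointwise_scale)
  show ?thesis
  proof unfold_locales
    show "subspace (family_space \<F> :: (nat \<Rightarrow> 'k) set)"
    proof (rule subspaceI)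
      show "0 \<in> (family_space \<F> :: (nat \<Rightarrow> 'k) set)"
        by (rule finite_support_in_family_space) auto
    qed (auto intro: family_space_add family_space_scale)
    fix x y :: "nat \<Rightarrow> 'k" and c :: 'k
    assume x: "x \<in> family_space \<F>"
    show nonneg: "0 \<le> family_norm \<F> x"
      using coordinate_le_family_norm[OF x, of 0] norm_ge_zero order_trans by blast
    show "family_norm \<F> x = 0 \<longleftrightarrow> x = 0"
    proof
      assume "family_norm \<F> x = 0"
      then show "x = 0"
        using coordinate_le_family_norm[OF x] by (auto simp: fun_eq_iff)
    next
      assume "x = 0"
      then have "family_norm \<F> x \<le> 0"
        by (intro family_norm_le) simp
      with nonneg show "family_norm \<F> x = 0" by simp
    qed
    show "family_norm \<F> (pointwise_scale c x) = norm c * family_norm \<F> x"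
    proof (cases "c = 0")
      case True
      have "pointwise_scale c x \<in> family_space \<F>"
        by (rule family_space_scale[OF x])
      from coordinate_le_family_norm[OF this, of 0] family_norm_scale_le[OF x, of c] True
      show ?thesis by simp
    next
      case False
      have "x = pointwise_scale (inverse c) (pointwise_scale c x)"
        using False by (simp add: fun_eq_iff)
      then have "family_norm \<F> x \<le> norm (inverse c) * family_norm \<F> (pointwise_scale c x)"
        using family_norm_scale_le[OF family_space_scale[OF x], of "inverse c" c] by simp
      then have "norm c * family_norm \<F> x \<le> family_norm \<F> (pointwise_scale c x)"
        using False by (simp add: norm_inverse field_simps norm_divide)
      then show ?thesis
        using family_norm_scale_le[OF x, of c] by simp
    qed
    assume y: "y \<in> family_space \<F>"
    show "family_norm \<F> (x + y) \<le> family_norm \<F> x + family_norm \<F> y"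
    proof (rule family_norm_le)
      fix F assume F: "F \<in> \<F>"
      have "(\<Sum>i\<in>F. norm ((x + y) i)) \<le> (\<Sum>i\<in>F. norm (x i)) + (\<Sum>i\<in>F. norm (y i))"
        by (simp add: sum.distrib[symmetric] sum_mono norm_triangle_ineq)
      with sum_le_family_norm[OF x F] sum_le_family_norm[OF y F]
      show "(\<Sum>i\<in>F. norm ((x + y) i)) \<le> family_norm \<F> x + family_norm \<F> y"
        by simp
    qed
  qed
qed

text \<open>Singletons make coordinates continuous, so a Cauchy sequence has a coordinatewise limit. Each
  sum in the norm has finitely many terms; hence the Cauchy estimates pass to this limit uniformly
  in the members of the family, which gives both membership and norm convergence.\<close>

lemma mcomplete_family_space:
  "Metric_space.mcomplete (family_space \<F> :: (nat \<Rightarrow> 'k::{real_normed_field,banach}) set)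
     (normed_space_on.nrm_dist (family_space \<F>) (family_norm \<F>))"
proof -
  interpret normed_space_on pointwise_scale "family_space \<F> :: (nat \<Rightarrow> 'k) set" "family_norm \<F>"
    by (rule normed_space_on_family_space)
  have diff: "x - y \<in> family_space \<F>" if "x \<in> family_space \<F>" "y \<in> family_space \<F>"
    for x y :: "nat \<Rightarrow> 'k"
    using subspace_diff[OF subspace_X] that by blast
  show ?thesis
    unfolding mcomplete_def
  proof (intro allI impI)
    fix \<sigma> :: "nat \<Rightarrow> nat \<Rightarrow> 'k"
    assume cauchy: "MCauchy \<sigma>"
    have \<sigma>: "\<sigma> k \<in> family_space \<F>" for k
      using cauchy by (auto simp: MCauchy_def)
    have small: "\<exists>K. \<forall>k\<ge>K. \<forall>l\<ge>K. family_norm \<F> (\<sigma> k - \<sigma> l) < \<epsilon>" if "\<epsilon> > 0" for \<epsilon>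
      using cauchy that \<sigma> by (simp add: MCauchy_def nrm_dist_def)
    have "Cauchy (\<lambda>k. \<sigma> k i)" for i
    proof (rule metric_CauchyI)
      fix \<epsilon> :: real assume "\<epsilon> > 0"
      then obtain K where K: "\<And>k l. k \<ge> K \<Longrightarrow> l \<ge> K \<Longrightarrow> family_norm \<F> (\<sigma> k - \<sigma> l) < \<epsilon>"
        using small by blast
      have "dist (\<sigma> k i) (\<sigma> l i) < \<epsilon>" if "k \<ge> K" "l \<ge> K" for k l
        using coordinate_le_family_norm[OF diff[OF \<sigma> \<sigma>], of k l i] K[OF that]
        by (simp add: dist_norm)
      then show "\<exists>M. \<forall>m\<ge>M. \<forall>n\<ge>M. dist (\<sigma> m i) (\<sigma> n i) < \<epsilon>"
        by blast
    qed
    then have "\<exists>l. (\<lambda>k. \<sigma> k i) \<longlonglongrightarrow> l" for i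
      using Cauchy_convergent unfolding convergent_def by blast
    then obtain x where x: "\<And>i. (\<lambda>k. \<sigma> k i) \<longlonglongrightarrow> x i"
      by metis
    have close: "\<exists>K. \<forall>k\<ge>K. \<forall>F\<in>\<F>. (\<Sum>i\<in>F. norm ((\<sigma> k - x) i)) \<le> \<epsilon>" if "\<epsilon> > 0" for \<epsilon>
    proof -
      obtain K where K: "\<And>k l. k \<ge> K \<Longrightarrow> l \<ge> K \<Longrightarrow> family_norm \<F> (\<sigma> k - \<sigma> l) < \<epsilon>"
        using small[OF \<open>\<epsilon> > 0\<close>] by blast
      have "(\<Sum>i\<in>F. norm ((\<sigma> k - x) i)) \<le> \<epsilon>" if "k \<ge> K" "F \<in> \<F>" for k F
      proof (rule tendsto_upperbound)
        show "(\<lambda>l. \<Sum>i\<in>F. norm ((\<sigma> k - \<sigma> l) i)) \<longlonglongrightarrow> (\<Sum>i\<in>F. norm ((\<sigma> k - x) i))"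
          by (simp, intro tendsto_intros x)
        show "\<forall>\<^sub>F l in sequentially. (\<Sum>i\<in>F. norm ((\<sigma> k - \<sigma> l) i)) \<le> \<epsilon>"
          using eventually_ge_at_top[of K]
        proof eventually_elim
          case (elim l)
          show ?case
            using sum_le_family_norm[OF diff[OF \<sigma> \<sigma>] \<open>F \<in> \<F>\<close>, of k l] K[OF \<open>k \<ge> K\<close> elim]
            by linarith
        qed
      qed simp
      then show ?thesis by blast
    qed
    have xX: "x \<in> family_space \<F>"
      unfolding family_space_def mem_Collect_eq
    proof (intro conjI allI impI)
      have "\<sigma> k 0 = 0" for k
        by (rule family_space_zero[OF \<sigma>])
      then show "x 0 = 0"
        using x[of 0] by (simp add: LIMSEQ_const_iff)
      fix \<epsilon> :: real assume "\<epsilon> > 0"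
      then have "\<epsilon> / 2 > 0" by simp
      then obtain k where k: "\<And>F. F \<in> \<F> \<Longrightarrow> (\<Sum>i\<in>F. norm ((\<sigma> k - x) i)) \<le> \<epsilon> / 2"
        using close by blast
      obtain N where N: "\<And>F. F \<in> \<F> \<Longrightarrow> F \<subseteq> {N..} \<Longrightarrow> (\<Sum>i\<in>F. norm (\<sigma> k i)) \<le> \<epsilon> / 2"
        using family_spaceD[OF \<sigma> \<open>\<epsilon> / 2 > 0\<close>] by blast
      have "(\<Sum>i\<in>F. norm (x i)) \<le> \<epsilon>" if F: "F \<in> \<F>" "F \<subseteq> {N..}" for F
      proof -
        have "norm (x i) \<le> norm (\<sigma> k i) + norm ((\<sigma> k - x) i)" for i
          using norm_triangle_ineq4[of "\<sigma> k i" "(\<sigma> k - x) i"] by simp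
        then have "(\<Sum>i\<in>F. norm (x i)) \<le> (\<Sum>i\<in>F. norm (\<sigma> k i)) + (\<Sum>i\<in>F. norm ((\<sigma> k - x) i))"
          by (simp add: sum.distrib[symmetric] sum_mono)
        with N[OF F] k[OF F(1)] show ?thesis by simp
      qed
      then show "\<exists>N. \<forall>F\<in>\<F>. F \<subseteq> {N..} \<longrightarrow> (\<Sum>i\<in>F. norm (x i)) \<le> \<epsilon>"
        by blast
    qed
    have "\<exists>K. \<forall>k\<ge>K. family_norm \<F> (\<sigma> k - x) < \<epsilon>" if "\<epsilon> > 0" for \<epsilon>
    proof -
      have "\<epsilon> / 2 > 0" using that by simp
      then obtain K where K: "\<And>k F. k \<ge> K \<Longrightarrow> F \<in> \<F> \<Longrightarrow> (\<Sum>i\<in>F. norm ((\<sigma> k - x) i)) \<le> \<epsilon> / 2"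
        using close by meson
      have "family_norm \<F> (\<sigma> k - x) < \<epsilon>" if "k \<ge> K" for k
        using family_norm_le[of "\<sigma> k - x", OF K[OF that]] \<open>\<epsilon> > 0\<close> by linarith
      then show ?thesis by blast
    qed
    then have "limitin mtopology \<sigma> x sequentially"
      using xX \<sigma> by (simp add: limitin_metric nrm_dist_def eventually_sequentially)
    then show "\<exists>x. limitin mtopology \<sigma> x sequentially" by blast
  qed
qed

text \<open>With \<open>D\<close> countable this yields separability, and a fortiori density of the span.\<close>

lemma finite_combinations_dense:
  fixes D :: "'k::real_normed_field set"
  assumes D: "\<And>z r. r > 0 \<Longrightarrow> \<exists>d\<in>D. dist d z < r" and x: "x \<in> family_space \<F>" and "r > 0"
  obtains a :: "nat \<Rightarrow> 'k" and N where "\<And>i. a i \<in> D"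
    "family_norm \<F> (x - (\<Sum>i=1..N. pointwise_scale (a i) (unit_seq i))) < r"
proof -
  have "r / 3 > 0" using \<open>r > 0\<close> by simp
  then obtain N where N: "\<And>F. F \<in> \<F> \<Longrightarrow> F \<subseteq> {N..} \<Longrightarrow> (\<Sum>i\<in>F. norm (x i)) \<le> r / 3"
    using family_spaceD[OF x] by blast
  \<comment> \<open>The \<open>N + 1\<close> coordinates up to \<open>N\<close> share an error of \<open>r / 3\<close>, the tail costs another \<open>r / 3\<close>.\<close>
  define \<delta> where "\<delta> = r / (3 * (real N + 1))"
  have "\<delta> > 0" using \<open>r > 0\<close> by (simp add: \<delta>_def)
  then have "\<forall>i. \<exists>d. d \<in> D \<and> dist d (x i) < \<delta>"
    using D by blast
  then obtain a where a: "\<And>i. a i \<in> D" "\<And>i. dist (a i) (x i) < \<delta>"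
    unfolding choice_iff by blast
  define y where "y = (\<Sum>i=1..N. pointwise_scale (a i) (unit_seq i))"
  have y: "y i = (if 1 \<le> i \<and> i \<le> N then a i else 0)" for i
    unfolding y_def by (subst unit_expansion_apply) auto
  have "(\<Sum>i\<in>F. norm ((x - y) i)) \<le> 2 * r / 3" if F: "F \<in> \<F>" for F
  proof -
    have "(\<Sum>i\<in>F. norm ((x - y) i)) \<le> (\<Sum>i<Suc N. \<delta>) + r / 3"
    proof (rule sum_split_at[OF F])
      show "norm ((x - y) i) \<le> \<delta>" if "i < Suc N" for i
        using a(2)[of i] that \<open>\<delta> > 0\<close> family_space_zero[OF x]
        by (cases "i = 0") (auto simp: y dist_norm norm_minus_commute)
      show "(\<Sum>i\<in>F. norm ((x - y) i)) \<le> r / 3" if "F \<in> \<F>" "F \<subseteq> {Suc N..}" for F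
      proof -
        have "(\<Sum>i\<in>F. norm ((x - y) i)) = (\<Sum>i\<in>F. norm (x i))"
          using that(2) by (intro sum.cong) (auto simp: y)
        then show ?thesis
          using N[OF that(1)] that(2) by fastforce
      qed
    qed simp
    also have "(\<Sum>i<Suc N. \<delta>) = r / 3"
      by (simp add: \<delta>_def field_simps)
    finally show ?thesis by simp
  qed
  then have "family_norm \<F> (x - y) \<le> 2 * r / 3"
    by (rule family_norm_le)
  with \<open>r > 0\<close> have "family_norm \<F> (x - y) < r" by simp
  with a(1) that show thesis
    unfolding y_def by blast
qed

lemma family_norm_unit_seq:
  assumes "1 \<le> i"
  shows "family_norm \<F> (unit_seq i :: nat \<Rightarrow> 'k::real_normed_field) = 1"
proof (rule antisym)
  show "family_norm \<F> (unit_seq i :: nat \<Rightarrow> 'k) \<le> 1"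
  proof (rule family_norm_le)
    fix F assume "F \<in> \<F>"
    have "(\<Sum>j\<in>F. norm (unit_seq i j :: 'k)) = (\<Sum>j\<in>F. if j = i then 1 else 0)"
      by (rule sum.cong) (auto simp: unit_seq_def)
    also have "\<dots> \<le> 1"
      using finite_member[OF \<open>F \<in> \<F>\<close>] by simp
    finally show "(\<Sum>j\<in>F. norm (unit_seq i j :: 'k)) \<le> 1" .
  qed
  show "1 \<le> family_norm \<F> (unit_seq i :: nat \<Rightarrow> 'k)"
    using coordinate_le_family_norm[OF unit_seq_in_family_space[OF assms], of i]
    by (simp add: unit_seq_def)
qed

lemma banach_basis_unit_seq:
  "banach_basis pointwise_scale
     (family_space \<F> :: (nat \<Rightarrow> 'k::{real_normed_field,banach,second_countable_topology}) set)
     (family_norm \<F>) unit_seq (\<lambda>i x. x i)"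
proof -
  interpret normed_space_on pointwise_scale "family_space \<F> :: (nat \<Rightarrow> 'k) set" "family_norm \<F>"
    by (rule normed_space_on_family_space)
  let ?E = "unit_seq ` {1..} :: (nat \<Rightarrow> 'k) set"
  have E_sub: "?E \<subseteq> family_space \<F>"
    using unit_seq_in_family_space by auto
  have span_sub: "span ?E \<subseteq> family_space \<F>"
    by (rule span_minimal[OF E_sub subspace_X])
  have diff: "x - y \<in> family_space \<F>" if "x \<in> family_space \<F>" "y \<in> family_space \<F>"
    for x y :: "nat \<Rightarrow> 'k"
    using subspace_diff[OF subspace_X] that by blast
  obtain D :: "'k set" where "countable D"
    and D: "\<And>S. open S \<Longrightarrow> S \<noteq> {} \<Longrightarrow> \<exists>d\<in>D. d \<in> S"
    by (rule countable_dense_setE) blast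
  have D_dense: "\<exists>d\<in>D. dist d z < r" if "r > 0" for z r
    using D[of "ball z r"] that by (auto simp: dist_commute)
  define comb :: "'k list \<Rightarrow> nat \<Rightarrow> 'k"
    where "comb = (\<lambda>ds. \<Sum>i=1..length ds. pointwise_scale (ds ! (i - 1)) (unit_seq i))"
  have comb_span: "comb ds \<in> span ?E" for ds
    unfolding comb_def by (intro span_sum span_scale span_base) auto
  have comb_dense: "mtopology closure_of (comb ` lists D) = family_space \<F>"
    unfolding metric_closure_of
  proof (intro equalityI subsetI CollectI conjI allI impI)
    fix x :: "nat \<Rightarrow> 'k" and r :: real assume x: "x \<in> family_space \<F>" and "0 < r"
    obtain a N where a: "\<And>i. a i \<in> D"
      and close: "family_norm \<F> (x - (\<Sum>i=1..N. pointwise_scale (a i) (unit_seq i))) < r"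
      using finite_combinations_dense[OF D_dense x \<open>0 < r\<close>] by blast
    define ds where "ds = map (\<lambda>i. a (Suc i)) [0..<N]"
    have "ds \<in> lists D"
      using a by (auto simp: ds_def)
    moreover have "comb ds = (\<Sum>i=1..N. pointwise_scale (a i) (unit_seq i))"
      unfolding comb_def ds_def by (rule sum.cong) auto
    then have "comb ds \<in> mball x r"
      using close x comb_span[of ds] span_sub by (auto simp: in_mball nrm_dist_def)
    ultimately show "\<exists>y\<in>comb ` lists D. y \<in> mball x r"
      by blast
  qed auto
  have indep: "independent ?E"
  proof
    assume "dependent ?E"
    then obtain T u v where T: "finite T" "T \<subseteq> ?E" "v \<in> T" "u v \<noteq> 0"
      and zero: "(\<Sum>w\<in>T. pointwise_scale (u w) w) = 0"
      unfolding dependent_explicit by blast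
    obtain i where i: "v = unit_seq i"
      using T by blast
    have "0 = (\<Sum>w\<in>T. pointwise_scale (u w) w i)"
      using fun_cong[OF zero, of i] by (simp add: sum_fun_apply)
    also have "\<dots> = (\<Sum>w\<in>T. if w = v then u v else 0)"
    proof (rule sum.cong[OF refl])
      fix w assume "w \<in> T"
      then obtain j where w: "w = unit_seq j"
        using T(2) by blast
      show "pointwise_scale (u w) w i = (if w = v then u v else 0)"
      proof (cases "i = j")
        case True
        then show ?thesis by (simp add: w i unit_seq_def)
      next
        case False
        then have "w i = 0" "v i = 1"
          by (simp_all add: w i unit_seq_def)
        then show ?thesis by auto
      qed
    qed
    also have "\<dots> = u v"
      using T by simp
    finally show False
      using T(4) by simp
  qed
  have "inj_on (unit_seq :: nat \<Rightarrow> nat \<Rightarrow> 'k) {1..}"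
  proof (rule inj_onI)
    fix i j :: nat assume "unit_seq i = (unit_seq j :: nat \<Rightarrow> 'k)"
    then have "unit_seq i i = (unit_seq j i :: 'k)" by simp
    then show "i = j" by (simp add: unit_seq_def split: if_splits)
  qed
  then have E_inf: "infinite ?E"
    using finite_imageD infinite_Ici by blast
  have dual: "dual_norm (\<lambda>x. x i) = 1" if "1 \<le> i" for i
  proof (rule antisym)
    have e: "(unit_seq i :: nat \<Rightarrow> 'k) \<in> {x \<in> family_space \<F>. family_norm \<F> x \<le> 1}"
      using unit_seq_in_family_space[OF that] family_norm_unit_seq[OF that, where 'k = 'k] by simp
    have bound: "norm (x i) \<le> 1" if "x \<in> {x \<in> family_space \<F>. family_norm \<F> x \<le> 1}"
      for x :: "nat \<Rightarrow> 'k"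
      using coordinate_le_family_norm[of x i] that by auto
    show "dual_norm (\<lambda>x. x i) \<le> 1"
      unfolding dual_norm_def by (rule cSUP_least) (use e bound in auto)
    have "norm (unit_seq i i :: 'k) \<le> dual_norm (\<lambda>x. x i)"
      unfolding dual_norm_def by (rule cSUP_upper[OF e]) (use bound in \<open>auto simp: bdd_above_def\<close>)
    then show "1 \<le> dual_norm (\<lambda>x. x i)"
      by (simp add: unit_seq_def)
  qed
  have norms: "(\<lambda>i. family_norm \<F> (unit_seq i :: nat \<Rightarrow> 'k)) ` {1..} \<union>
      (\<lambda>i. dual_norm (\<lambda>x. x i)) ` {1..} = {1}"
  proof -
    have "(\<lambda>i. family_norm \<F> (unit_seq i :: nat \<Rightarrow> 'k)) ` {1..} = (\<lambda>i::nat. 1) ` {1..}"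
      by (rule image_cong[OF refl]) (use family_norm_unit_seq in auto)
    moreover have "(\<lambda>i. dual_norm (\<lambda>x. x i)) ` {1..} = (\<lambda>i::nat. 1) ` {1..}"
      by (rule image_cong[OF refl]) (use dual in auto)
    ultimately show ?thesis by (simp add: image_constant_conv)
  qed
  show ?thesis
  proof unfold_locales
    show "mcomplete"
      by (rule mcomplete_family_space)
    show "separable_space mtopology"
      unfolding separable_space_def
    proof (intro exI conjI)
      show "countable (comb ` lists D)"
        using \<open>countable D\<close> by (intro countable_image countable_lists)
      show "comb ` lists D \<subseteq> topspace mtopology"
        using comb_span span_sub by auto
      show "mtopology closure_of (comb ` lists D) = topspace mtopology"
        using comb_dense by simp
    qed
    show "\<nexists>B. finite B \<and> (family_space \<F> :: (nat \<Rightarrow> 'k) set) \<subseteq> span B"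
      using independent_span_bound[OF _ indep] E_sub E_inf by blast
    show "?E \<subseteq> family_space \<F>"
      by (rule E_sub)
    have "mtopology closure_of (comb ` lists D) \<subseteq> mtopology closure_of (span ?E)"
      using comb_span by (intro closure_of_mono) auto
    then show "mtopology closure_of (span ?E) = family_space \<F>"
      using comb_dense closure_of_subset_topspace[of mtopology "span ?E"] by auto
    show "(\<lambda>i x. x i) ` {1..} \<subseteq> dual_space"
      unfolding dual_space_def using coordinate_le_family_norm
      by (auto intro!: exI[of _ 1])
    show "unit_seq k j = (if j = k then 1 else 0)" for j k
      by (simp add: unit_seq_def)
    show "0 < Inf ((\<lambda>i. family_norm \<F> (unit_seq i :: nat \<Rightarrow> 'k)) ` {1..} \<union>
        (\<lambda>i. dual_norm (\<lambda>x. x i)) ` {1..})"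
      by (simp only: norms) simp
    show "bdd_above ((\<lambda>i. family_norm \<F> (unit_seq i :: nat \<Rightarrow> 'k)) ` {1..} \<union>
        (\<lambda>i. dual_norm (\<lambda>x. x i)) ` {1..})"
      by (simp only: norms) simp
  qed
qed

lemma one_unconditional_unit_seq:
  "one_unconditional pointwise_scale (family_norm \<F>)
     (unit_seq :: nat \<Rightarrow> nat \<Rightarrow> 'k::real_normed_field)"
  unfolding one_unconditional_def
proof (intro allI impI)
  fix N and a b :: "nat \<Rightarrow> 'k"
  assume le: "\<forall>i\<in>{1..N}. norm (a i) \<le> norm (b i)"
  show "family_norm \<F> (\<Sum>i=1..N. pointwise_scale (a i) (unit_seq i))
      \<le> family_norm \<F> (\<Sum>i=1..N. pointwise_scale (b i) (unit_seq i))"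
  proof (rule family_norm_mono)
    show "(\<Sum>i=1..N. pointwise_scale (b i) (unit_seq i)) \<in> family_space \<F>"
      by (rule finite_support_in_family_space) (auto simp: unit_expansion_apply)
  qed (use le in \<open>auto simp: unit_expansion_apply\<close>)
qed

section \<open>Greedy approximation and democracy in terms of the family\<close>

text \<open>Passing from \<open>x - P D x\<close> to \<open>x - P A x\<close> can only add the coordinates in \<open>D - A\<close>. For a member
  \<open>F\<close> of the family these form a set \<open>G = F \<inter> D - A\<close>, and a member of the same size inside \<open>A - D\<close>
  carries at least as much mass, as \<open>A\<close> is greedy; but on \<open>A - D\<close> the sequences \<open>x\<close> and
  \<open>x - P D x\<close> agree. Together with the coordinates outside \<open>D\<close> this costs the factor 2.\<close>

lemma greedy_error_le:
  fixes x :: "nat \<Rightarrow> 'k::real_normed_field"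
  assumes x: "x \<in> family_space \<F>" and A: "greedy_set (\<lambda>i x. x i) x m A"
    and D: "finite D" "D \<subseteq> {1..}" "card D \<le> m"
    and exchange: "\<And>G B. \<lbrakk>G \<in> \<F>; G \<subseteq> D; finite B; B \<subseteq> {1..}; B \<inter> D = {};
        m - card D + card G \<le> card B\<rbrakk> \<Longrightarrow> \<exists>H\<in>\<F>. H \<subseteq> B \<and> card H = card G"
  shows "family_norm \<F> (x - coord_proj pointwise_scale unit_seq (\<lambda>i x. x i) A x)
    \<le> 2 * family_norm \<F> (x - coord_proj pointwise_scale unit_seq (\<lambda>i x. x i) D x)"
proof (rule family_norm_le)
  fix F assume F: "F \<in> \<F>"
  have finA: "finite A" and "A \<subseteq> {1..}" and cardA: "card A = m"
    and greedy: "\<And>i j. i \<in> A \<Longrightarrow> j \<ge> 1 \<Longrightarrow> j \<notin> A \<Longrightarrow> norm (x j) \<le> norm (x i)"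
    using A by (auto simp: greedy_set_def)
  define y where "y = x - coord_proj pointwise_scale unit_seq (\<lambda>i x. x i) D x"
  have y: "y i = (if i \<in> D then 0 else x i)" for i
    by (simp add: y_def coord_proj_unit_seq D)
  have yX: "y \<in> family_space \<F>"
    by (rule family_space_mono[OF x]) (simp add: y)
  define G where "G = F \<inter> D - A"
  have G: "G \<in> \<F>" "G \<subseteq> D" "finite G"
    using subset_member[OF F, of G] D by (auto simp: G_def)
  have "card (A - D) + card (A \<inter> D) = m"
    using cardA finA by (metis add.commute card_Int_Diff)
  moreover have "card (D - A) + card (A \<inter> D) = card D"
    using D by (metis add.commute card_Int_Diff inf_commute)
  moreover have "card G \<le> card (D - A)"
    using D by (intro card_mono) (auto simp: G_def)
  ultimately have "m - card D + card G \<le> card (A - D)"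
    using D(3) by linarith
  then obtain H where H: "H \<in> \<F>" "H \<subseteq> A - D" "card H = card G"
    using exchange[of G "A - D"] G finA \<open>A \<subseteq> {1..}\<close> by blast
  have "(\<Sum>i\<in>G. norm (x i)) \<le> (\<Sum>i\<in>H. norm (x i))"
  proof (cases "G = {}")
    case True
    then show ?thesis by (simp add: sum_nonneg)
  next
    case False
    define c where "c = Max ((\<lambda>i. norm (x i)) ` G)"
    have "c \<in> (\<lambda>i. norm (x i)) ` G"
      unfolding c_def using False G by (intro Max_in) auto
    then obtain g where g: "g \<in> G" "c = norm (x g)" by blast
    have "(\<Sum>i\<in>G. norm (x i)) \<le> real (card G) * c"
      by (rule sum_bounded_above) (use G in \<open>auto simp: c_def\<close>)
    also have "\<dots> = real (card H) * c"
      by (simp add: H)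
    also have "\<dots> \<le> (\<Sum>i\<in>H. norm (x i))"
    proof (rule sum_bounded_below)
      fix i assume "i \<in> H"
      then show "c \<le> norm (x i)"
        using greedy[of i g] g H(2) G(2) D(2) by (auto simp: G_def)
    qed
    finally show ?thesis .
  qed
  also have "\<dots> = (\<Sum>i\<in>H. norm (y i))"
    using H(2) by (intro sum.cong) (auto simp: y)
  also have "\<dots> \<le> family_norm \<F> y"
    by (rule sum_le_family_norm[OF yX H(1)])
  finally have inside: "(\<Sum>i\<in>G. norm (x i)) \<le> family_norm \<F> y" .
  have "(\<Sum>i\<in>F. norm ((x - coord_proj pointwise_scale unit_seq (\<lambda>i x. x i) A x) i))
      \<le> (\<Sum>i\<in>F. (if i \<in> G then norm (x i) else 0) + norm (y i))"
    by (rule sum_mono) (auto simp: coord_proj_unit_seq finA G_def y)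
  also have "\<dots> = (\<Sum>i\<in>F. if i \<in> G then norm (x i) else 0) + (\<Sum>i\<in>F. norm (y i))"
    by (rule sum.distrib)
  also have "(\<Sum>i\<in>F. if i \<in> G then norm (x i) else 0) = (\<Sum>i\<in>F \<inter> G. norm (x i))"
    using finite_member[OF F] by (simp add: sum.inter_restrict)
  also have "F \<inter> G = G"
    by (auto simp: G_def)
  also have "(\<Sum>i\<in>G. norm (x i)) + (\<Sum>i\<in>F. norm (y i)) \<le> 2 * family_norm \<F> y"
    using inside sum_le_family_norm[OF yX F] by simp
  finally show "(\<Sum>i\<in>F. norm ((x - coord_proj pointwise_scale unit_seq (\<lambda>i x. x i) A x) i))
      \<le> 2 * family_norm \<F> (x - coord_proj pointwise_scale unit_seq (\<lambda>i x. x i) D x)"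
    unfolding y_def .
qed

lemma family_norm_indicator_ge:
  assumes "A \<in> \<F>"
  shows "real (card A) \<le> family_norm \<F> (\<Sum>i\<in>A. unit_seq i :: nat \<Rightarrow> 'k::real_normed_field)"
proof -
  have fin: "finite A" and "0 \<notin> A"
    using finite_member[OF assms] member_pos[OF assms] by auto
  have "(\<Sum>i\<in>A. unit_seq i :: nat \<Rightarrow> 'k) \<in> family_space \<F>"
    by (rule finite_support_in_family_space) (use fin \<open>0 \<notin> A\<close> in \<open>auto simp: unit_sum_apply\<close>)
  from sum_le_family_norm[OF this assms] show ?thesis
    using fin by (simp add: unit_sum_apply)
qed

lemma family_norm_indicator_le:
  assumes "finite B" and "\<And>F. F \<in> \<F> \<Longrightarrow> card (F \<inter> B) \<le> c"
  shows "family_norm \<F> (\<Sum>i\<in>B. unit_seq i :: nat \<Rightarrow> 'k::real_normed_field) \<le> real c"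
proof (rule family_norm_le)
  fix F assume F: "F \<in> \<F>"
  have "(\<Sum>i\<in>F. norm ((\<Sum>i\<in>B. unit_seq i :: nat \<Rightarrow> 'k) i)) = (\<Sum>i\<in>F. if i \<in> B then 1 else 0)"
    by (rule sum.cong) (auto simp: unit_sum_apply assms)
  also have "\<dots> = real (card (F \<inter> B))"
    using finite_member[OF F] by (simp add: sum.inter_restrict[symmetric])
  finally show "(\<Sum>i\<in>F. norm ((\<Sum>i\<in>B. unit_seq i :: nat \<Rightarrow> 'k) i)) \<le> real c"
    using assms(2)[OF F] by simp
qed

end

section \<open>The family adapted to a sequence with large gaps\<close>

text \<open>\<open>S j\<close> is the left end of the \<open>j\<close>-th chosen gap. The length four times the block size leaves room for
  the two blocks, and for as many elements again as \<open>gap_family_exchange\<close> must find.\<close>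

locale gap_sequence =
  fixes n s S :: "nat \<Rightarrow> nat"
  assumes n_mono: "strict_mono_on {1..} n" and n_pos: "1 \<le> k \<Longrightarrow> 1 \<le> n k"
    and gap: "m \<in> s ` {1..} \<Longrightarrow> S j < m \<Longrightarrow> S j + 4 * fact (Suc j) \<le> m"
    and separated: "i < j \<Longrightarrow> S i + 4 * fact (Suc i) \<le> S j"
begin

definition heavy :: "nat \<Rightarrow> nat set" where
  "heavy j = n ` {S j<..S j + fact (Suc j)}"

definition light :: "nat \<Rightarrow> nat set" where
  "light j = n ` {S j + fact (Suc j)<..S j + 2 * fact (Suc j)}"

text \<open>The alternative \<open>card F \<le> 1\<close> is there for the singletons among the early terms of \<open>n\<close>.\<close>

definition gap_family :: "nat set set" where
  "gap_family = {F. finite F \<and> F \<subseteq> {1..} \<and> (\<forall>j. card (F \<inter> light j) \<le> fact j) \<and>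
     (card F \<le> 1 \<or> (\<exists>j. card F \<le> fact (Suc j) \<and> F \<inter> n ` {1..S j} = {}))}"

lemma n_inj: "inj_on n {1..}"
  by (rule strict_mono_on_imp_inj_on[OF n_mono])

lemma card_n_image: "I \<subseteq> {1..} \<Longrightarrow> card (n ` I) = card I"
  by (rule card_image) (rule inj_on_subset[OF n_inj])

lemma n_image_disjoint:
  "I \<subseteq> {1..} \<Longrightarrow> J \<subseteq> {1..} \<Longrightarrow> I \<inter> J = {} \<Longrightarrow> n ` I \<inter> n ` J = {}"
  using inj_on_image_Int[OF n_inj, of I J] by simp

lemma finite_light: "finite (light j)"
  by (simp add: light_def)

lemma card_light: "card (light j) = fact (Suc j)"
  unfolding light_def by (subst card_n_image) auto

lemma card_heavy: "card (heavy j) = fact (Suc j)"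
  unfolding heavy_def by (subst card_n_image) auto

lemma heavy_less_light:
  assumes "a \<in> heavy j" "b \<in> light j"
  shows "a < b"
  using assms unfolding heavy_def light_def
  by (auto intro!: strict_mono_onD[OF n_mono])

lemma light_sub_initial:
  assumes "i < j"
  shows "light i \<subseteq> n ` {1..S j}"
  using separated[OF assms] unfolding light_def by (intro image_mono) auto

lemma heavy_in_gap_family: "heavy j \<in> gap_family"
proof -
  have "heavy j \<inter> light i = {}" for i
  proof -
    have "{S j<..S j + fact (Suc j)} \<inter> {S i + fact (Suc i)<..S i + 2 * fact (Suc i)} = {}"
      using separated[of i j] separated[of j i] by (cases i j rule: linorder_cases) auto
    then show ?thesis
      unfolding heavy_def light_def by (intro n_image_disjoint) auto
  qed
  moreover have "heavy j \<inter> n ` {1..S j} = {}"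
    unfolding heavy_def by (intro n_image_disjoint) auto
  moreover have "heavy j \<subseteq> {1..}" "finite (heavy j)"
    using n_pos by (auto simp: heavy_def)
  ultimately show ?thesis
    unfolding gap_family_def using card_heavy[of j] by auto
qed

lemma hereditary_gap_family: "hereditary_family gap_family"
proof
  fix F G assume F: "F \<in> gap_family" and "G \<subseteq> F"
  have "finite F" using F by (simp add: gap_family_def)
  then have "card G \<le> card F" and "card (G \<inter> light j) \<le> card (F \<inter> light j)" for j
    using \<open>G \<subseteq> F\<close> by (auto intro!: card_mono)
  then show "G \<in> gap_family"
    using F \<open>G \<subseteq> F\<close> unfolding gap_family_def mem_Collect_eq
    by (meson disjoint_iff finite_subset order_trans subsetD)
next
  fix i :: nat assume "1 \<le> i"
  have "card ({i} \<inter> light j) \<le> fact j" for j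
    by (rule order_trans[OF card_mono[of "{i}"]]) (auto simp: Suc_le_eq)
  with \<open>1 \<le> i\<close> show "{i} \<in> gap_family"
    by (simp add: gap_family_def)
qed (auto simp: gap_family_def)

text \<open>This is where \<open>m \<in> s\<close> enters: a terminal index \<open>k\<close> inside the \<open>j\<close>-th gap forces \<open>m\<close> beyond its
  end, so that \<open>B\<close> is much larger than the \<open>j\<close>-th light block whenever it can meet that block.\<close>

lemma gap_family_exchange:
  assumes m: "m \<in> s ` {1..}" "k \<le> m" and G: "G \<in> gap_family" "G \<subseteq> n ` {1..k}"
    and B: "finite B" "B \<subseteq> {1..}" "B \<inter> n ` {1..k} = {}" "m - k + card G \<le> card B"
  shows "\<exists>H\<in>gap_family. H \<subseteq> B \<and> card H = card G"
proof (cases "card G \<le> 1")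
  case True
  obtain H where H: "H \<subseteq> B" "card H = card G" "finite H"
    using obtain_subset_with_card_n[of "card G" B] B(4) by auto
  have "card (H \<inter> light j) \<le> fact j" for j
  proof -
    have "card (H \<inter> light j) \<le> card H"
      using H by (intro card_mono) auto
    also have "\<dots> \<le> 1"
      using H True by simp
    also have "1 \<le> (fact j :: nat)"
      by (rule fact_ge_1)
    finally show ?thesis .
  qed
  then have "H \<in> gap_family"
    using H True B unfolding gap_family_def by auto
  with H show ?thesis by blast
next
  case False
  then obtain j where j: "card G \<le> fact (Suc j)" "G \<inter> n ` {1..S j} = {}"
    using G(1) by (auto simp: gap_family_def)
  have "S j < k"
  proof (rule ccontr)
    assume "\<not> S j < k"
    then have "n ` {1..k} \<subseteq> n ` {1..S j}" by (intro image_mono) auto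
    with G(2) j(2) have "G = {}" by blast
    with False show False by simp
  qed
  then have long: "S j + 4 * fact (Suc j) \<le> m"
    using gap[OF m(1)] m(2) by simp
  have "card G \<le> card (B - light j)"
  proof (cases "S j + 2 * fact (Suc j) \<le> k")
    case True
    have "light j \<subseteq> n ` {1..k}"
      unfolding light_def by (intro image_mono) (use True in auto)
    with B(3) have "B - light j = B" by blast
    with B(4) show ?thesis by simp
  next
    case False
    then have "2 * fact (Suc j) \<le> card B"
      using long B(4) by linarith
    moreover have "card B - card (light j) \<le> card (B - light j)"
      by (rule diff_card_le_card_Diff[OF finite_light])
    ultimately show ?thesis
      using card_light[of j] j(1) by linarith
  qed
  then obtain H where H: "H \<subseteq> B - light j" "card H = card G" "finite H"
    using obtain_subset_with_card_n[of "card G" "B - light j"] by auto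
  have "card (H \<inter> light i) \<le> fact i" for i
  proof (cases i j rule: linorder_cases)
    case less
    have "light i \<subseteq> n ` {1..k}"
      using light_sub_initial[OF less] \<open>S j < k\<close> by (meson atLeastatMost_subset_iff image_mono
          less_imp_le order_refl order_trans)
    then have "H \<inter> light i = {}"
      using H(1) B(3) by blast
    then show ?thesis by simp
  next
    case equal
    then have "H \<inter> light i = {}"
      using H(1) by blast
    then show ?thesis by simp
  next
    case greater
    have "card (H \<inter> light i) \<le> card H"
      using H by (intro card_mono) auto
    also have "\<dots> \<le> fact (Suc j)"
      using H j by simp
    also have "\<dots> \<le> (fact i :: nat)"
      using greater by (intro fact_mono) auto
    finally show ?thesis .
  qed
  moreover have "n ` {1..S j} \<subseteq> n ` {1..k}"
    using \<open>S j < k\<close> by (intro image_mono) auto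
  then have "H \<inter> n ` {1..S j} = {}"
    using H(1) B(3) by blast
  ultimately have "H \<in> gap_family"
    using H B(2) j(1) unfolding gap_family_def by auto
  with H show ?thesis by blast
qed

lemma strong_partially_greedy_gap_family:
  "strong_partially_greedy pointwise_scale
     (family_space gap_family :: (nat \<Rightarrow> 'k::real_normed_field) set)
     (family_norm gap_family) unit_seq (\<lambda>i x. x i) s n"
  unfolding strong_partially_greedy_def
proof (intro exI[of _ 2] conjI ballI allI impI)
  interpret hereditary_family gap_family
    by (rule hereditary_gap_family)
  fix x :: "nat \<Rightarrow> 'k" and m A
  assume x: "x \<in> family_space gap_family" and m: "m \<in> s ` {1..}"
    and A: "greedy_set (\<lambda>i x. x i) x m A"
  let ?P = "coord_proj pointwise_scale (unit_seq :: nat \<Rightarrow> nat \<Rightarrow> 'k) (\<lambda>i x. x i)"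
  have "seq_sigma pointwise_scale (family_norm gap_family) unit_seq (\<lambda>i x. x i) n m x
      \<in> (\<lambda>k. family_norm gap_family (x - seq_partial_sum pointwise_scale unit_seq (\<lambda>i x. x i) n k x))
        ` {0..m}"
    unfolding seq_sigma_def by (rule Min_in) auto
  then obtain k where k: "k \<le> m"
    "seq_sigma pointwise_scale (family_norm gap_family) unit_seq (\<lambda>i x. x i) n m x
      = family_norm gap_family (x - seq_partial_sum pointwise_scale unit_seq (\<lambda>i x. x i) n k x)"
    by auto
  have "seq_partial_sum pointwise_scale unit_seq (\<lambda>i x. x i) n k x = ?P (n ` {1..k}) x"
    unfolding seq_partial_sum_def coord_proj_def
    by (subst sum.reindex) (auto intro: inj_on_subset[OF n_inj])
  moreover have "family_norm gap_family (x - ?P A x)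
      \<le> 2 * family_norm gap_family (x - ?P (n ` {1..k}) x)"
  proof (rule greedy_error_le[OF x A])
    have card: "card (n ` {1..k}) = k"
      by (subst card_n_image) auto
    show "card (n ` {1..k}) \<le> m"
      using card k(1) by simp
    show "n ` {1..k} \<subseteq> {1..}"
      using n_pos by auto
    show "\<exists>H\<in>gap_family. H \<subseteq> B \<and> card H = card G"
      if "G \<in> gap_family" "G \<subseteq> n ` {1..k}" "finite B" "B \<subseteq> {1..}" "B \<inter> n ` {1..k} = {}"
        "m - card (n ` {1..k}) + card G \<le> card B" for G B
      using gap_family_exchange[OF m k(1) that(1-5)] that(6) card by simp
  qed simp
  ultimately show "family_norm gap_family (x - ?P A x)
      \<le> 2 * seq_sigma pointwise_scale (family_norm gap_family) unit_seq (\<lambda>i x. x i) n m x"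
    using k(2) by simp
qed simp

lemma not_conservative_gap_family:
  "\<not> conservative (family_norm gap_family) (unit_seq :: nat \<Rightarrow> nat \<Rightarrow> 'k::real_normed_field) n"
proof
  interpret hereditary_family gap_family
    by (rule hereditary_gap_family)
  assume "conservative (family_norm gap_family) (unit_seq :: nat \<Rightarrow> nat \<Rightarrow> 'k) n"
  then obtain C where C: "C > 0"
    and cons: "\<forall>A B. finite A \<and> finite B \<and> A \<subseteq> n ` {1..} \<and> B \<subseteq> {1..} \<and> card A \<le> card B \<and>
        (\<forall>a\<in>A. \<forall>b\<in>B \<inter> n ` {1..}. a < b) \<longrightarrow>
        family_norm gap_family (\<Sum>i\<in>A. unit_seq i :: nat \<Rightarrow> 'k)
          \<le> C * family_norm gap_family (\<Sum>i\<in>B. unit_seq i :: nat \<Rightarrow> 'k)"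
    unfolding conservative_def by (elim exE conjE)
  obtain j :: nat where "C < real j"
    using reals_Archimedean2 by blast
  have "real (Suc j) * fact j = real (card (heavy j))"
    by (simp add: card_heavy algebra_simps)
  also have "\<dots> \<le> family_norm gap_family (\<Sum>i\<in>heavy j. unit_seq i :: nat \<Rightarrow> 'k)"
    by (rule family_norm_indicator_ge[OF heavy_in_gap_family])
  also have "\<dots> \<le> C * family_norm gap_family (\<Sum>i\<in>light j. unit_seq i :: nat \<Rightarrow> 'k)"
  proof (rule cons[rule_format], intro conjI)
    show "finite (heavy j)"
      using finite_member[OF heavy_in_gap_family] .
    show "heavy j \<subseteq> n ` {1..}"
      unfolding heavy_def by (intro image_mono) auto
    show "light j \<subseteq> {1..}"
      using n_pos by (auto simp: light_def)
  qed (auto simp: finite_light card_light card_heavy heavy_less_light)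
  also have "\<dots> \<le> C * real (fact j)"
    using C by (intro mult_left_mono family_norm_indicator_le[OF finite_light])
      (auto simp: gap_family_def)
  finally have "real (Suc j) * fact j \<le> C * fact j"
    by simp
  then have "real (Suc j) \<le> C"
    by simp
  with \<open>C < real j\<close> show False by simp
qed

end

text \<open>A supremum over finitely many indices is finite, so unboundedly large gaps occur arbitrarily far
  out; this allows the gaps to be chosen one after the other.\<close>

lemma arbitrarily_late_large_gaps:
  fixes s :: "nat \<Rightarrow> nat"
  assumes "(SUP k\<in>{1..}. enat (s (k + 1) - s k)) = \<infinity>"
  shows "\<exists>k>K. s k + g \<le> s (k + 1)"
proof (rule ccontr)
  assume "\<not> ?thesis"
  then have small: "\<And>k. k > K \<Longrightarrow> s (k + 1) < s k + g"
    by (meson not_le)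
  define M where "M = g + (\<Sum>k\<le>K. s (k + 1) - s k)"
  have "s (k + 1) - s k \<le> M" for k
  proof (cases "k \<le> K")
    case True
    then have "s (k + 1) - s k \<le> (\<Sum>k\<le>K. s (k + 1) - s k)"
      by (intro member_le_sum) auto
    then show ?thesis by (simp add: M_def)
  next
    case False
    then show ?thesis using small[of k] by (simp add: M_def)
  qed
  then have "(SUP k\<in>{1..}. enat (s (k + 1) - s k)) \<le> enat M"
    by (intro SUP_least) simp
  with assms show False by simp
qed

lemma gap_sequence_exists:
  fixes n s :: "nat \<Rightarrow> nat"
  assumes n: "strict_mono_on {1..} n" "\<forall>k\<ge>1. 1 \<le> n k"
    and s: "strict_mono_on {1..} s"
    and gaps: "(SUP k\<in>{1..}. enat (s (k + 1) - s k)) = \<infinity>"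
  obtains S where "gap_sequence n s S"
proof -
  have s_le: "s i \<le> s j" if "1 \<le> i" "i \<le> j" for i j
    using strict_mono_on_leD[OF s] that by simp
  have "\<exists>t. \<forall>j. (0 < t j \<and> s (t j) + 4 * fact (Suc j) \<le> s (t j + 1)) \<and> t j < t (Suc j)"
    by (rule dependent_nat_choice)
      (use arbitrarily_late_large_gaps[OF gaps] in \<open>blast intro: le_less_trans[of 0]\<close>)+
  then obtain t where t_pos: "\<And>j. 0 < t j"
    and t_gap: "\<And>j. s (t j) + 4 * fact (Suc j) \<le> s (t j + 1)" and t_step: "\<And>j. t j < t (Suc j)"
    by blast
  have t_mono: "t i < t j" if "i < j" for i j
    using lift_Suc_mono_less[of t, OF t_step that] .
  have "gap_sequence n s (\<lambda>j. s (t j))"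
  proof
    fix m j assume "m \<in> s ` {1..}" and less: "s (t j) < m"
    then obtain k where k: "1 \<le> k" "m = s k" by auto
    have "t j < k"
      using s_le[of k "t j"] k less by (meson not_le)
    then have "s (t j + 1) \<le> s k"
      by (intro s_le) auto
    then show "s (t j) + 4 * fact (Suc j) \<le> m"
      using t_gap[of j] k by linarith
  next
    fix i j :: nat assume "i < j"
    then have "s (t i + 1) \<le> s (t j)"
      using t_mono[of i j] by (intro s_le) auto
    then show "s (t i) + 4 * fact (Suc i) \<le> s (t j)"
      using t_gap[of i] by linarith
  qed (use n in auto)
  then show thesis by (rule that)
qed

theorem proposition7p23:
  fixes n s :: "nat \<Rightarrow> nat"
  assumes "strict_mono_on {1..} n" and "\<forall>k\<ge>1. 1 \<le> n k"
    and "strict_mono_on {1..} s" and "\<forall>k\<ge>1. 1 \<le> s k"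
    and "(SUP k\<in>{1..}. enat (s (k + 1) - s k)) = \<infinity>"
  shows "(\<exists>(smul :: real \<Rightarrow> (nat \<Rightarrow> real) \<Rightarrow> (nat \<Rightarrow> real)) X nrm e e'.
            banach_basis smul X nrm e e' \<and> one_unconditional smul nrm e \<and>
            strong_partially_greedy smul X nrm e e' s n \<and> \<not> conservative nrm e n)
       \<and> (\<exists>(smul :: complex \<Rightarrow> (nat \<Rightarrow> complex) \<Rightarrow> (nat \<Rightarrow> complex)) X nrm e e'.
            banach_basis smul X nrm e e' \<and> one_unconditional smul nrm e \<and>
            strong_partially_greedy smul X nrm e e' s n \<and> \<not> conservative nrm e n)"
proof -
  obtain S where "gap_sequence n s S"
    using gap_sequence_exists assms by blast
  then interpret gap_sequence n s S .
  interpret hereditary_family gap_family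
    by (rule hereditary_gap_family)
  show ?thesis
    using banach_basis_unit_seq[where 'k = real] banach_basis_unit_seq[where 'k = complex]
      one_unconditional_unit_seq[where 'k = real] one_unconditional_unit_seq[where 'k = complex]
      strong_partially_greedy_gap_family[where 'k = real]
      strong_partially_greedy_gap_family[where 'k = complex]
      not_conservative_gap_family[where 'k = real] not_conservative_gap_family[where 'k = complex]
    by blast
qed

end
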